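(* For every $\varepsilon>0$ there exist $\delta=\delta(\varepsilon)>0$ and $N=N(\varepsilon)$ such that the following holds for every $n\ge N$. Let $G$ be a graph on a vertex set $V$ with a partition $V=V_1\cup V_2\cup V_3$. Suppose that $\max_{i\in[3]}\big||V_i|-n\big|\le \delta n$ and $\rho_3(G)\le\delta$. Then $|G|\le \frac{5}{2}n^2+\varepsilon n^2$.
   Context: $|G|$ denotes the number of edges of $G$. For a graph $G$ on $V$ with a fixed partition $V=V_1\cup V_2\cup V_3$, a $3$-set $\{u,v,w\}\subseteq V$ is a triangle of type $V_iV_jV_k$ if it spans a triangle in $G$ and $(u,v,w)\in V_i\times V_j\times V_k$. $\rho_3(G)$ is the probability that a uniformly random $3$-subset of $V$ spans a triangle of one of the types $V_1V_2V_3$, $V_1V_1V_2$, $V_2V_2V_3$, $V_3V_3V_1$ (i.e. one vertex in each part; or two vertices in $V_1$ and one in $V_2$; or two in $V_2$ and one in $V_3$; or two in $V_3$ and one in $V_1$). *)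

theory Defs
  imports "HOL-Probability.Probability"
begin

text \<open>A finite simple graph is given by its vertex set \<open>V\<close> and its set \<open>E\<close> of edges, which are
  2-element subsets of \<open>V\<close>; thus the number of edges \<open>|G|\<close> is \<open>card E\<close>.\<close>

definition simple_graph :: "'a set \<Rightarrow> 'a set set \<Rightarrow> bool" where
  "simple_graph V E \<longleftrightarrow> finite V \<and> (\<forall>e\<in>E. e \<subseteq> V \<and> card e = 2)"

text \<open>The parts are a family \<open>P\<close>, of which only the indices \<open>1, 2, 3\<close> matter. Parts may be empty,
  unlike in \<open>partition_on\<close>.\<close>

definition tripartition :: "'a set \<Rightarrow> (nat \<Rightarrow> 'a set) \<Rightarrow> bool" where
  "tripartition V P \<longleftrightarrow> disjoint_family_on P {1..3} \<and> (\<Union>i\<in>{1..3}. P i) = V"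

definition triangle_of_type ::
    "'a set set \<Rightarrow> (nat \<Rightarrow> 'a set) \<Rightarrow> nat \<Rightarrow> nat \<Rightarrow> nat \<Rightarrow> 'a set \<Rightarrow> bool" where
  "triangle_of_type E P i j k T \<longleftrightarrow>
     (\<exists>u v w. T = {u, v, w} \<and> card T = 3 \<and> {u, v} \<in> E \<and> {v, w} \<in> E \<and> {u, w} \<in> E \<and>
              (u, v, w) \<in> P i \<times> P j \<times> P k)"

text \<open>\<open>pmf_of_set\<close> is unspecified on the empty set, so \<open>rho3\<close> is meaningful only if
  \<open>V\<close> is finite with at least three elements.\<close>

definition rho3 :: "'a set \<Rightarrow> 'a set set \<Rightarrow> (nat \<Rightarrow> 'a set) \<Rightarrow> real" where
  "rho3 V E P =
     measure_pmf.prob (pmf_of_set {T. T \<subseteq> V \<and> card T = 3})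
       {T. triangle_of_type E P 1 2 3 T \<or> triangle_of_type E P 1 1 2 T \<or>
           triangle_of_type E P 2 2 3 T \<or> triangle_of_type E P 3 3 1 T}"

end

theory Submission
  imports Defs
begin

text \<open>
  Call a triangle bad if it has one of the four types. Sampling \<open>m\<close> vertices from each part
  independently, with repetition, gives a graph on \<open>3 m\<close> labels which has the same densities as
  \<open>G\<close> in expectation, up to \<open>O(1/m)\<close>, and which contains a bad triangle with probability
  \<open>O(m\<^sup>3 \<delta>)\<close>. So it suffices to bound graphs without bad triangles.

  For these, put a probability measure \<open>w\<close> on each part and consider the quadratic form
  \<open>\<Sum> w x * w y\<close> over adjacent ordered pairs. If \<open>u\<close> and \<open>v\<close> are nonadjacent and lie in the same part,
  the form is linear along the shift of weight between them, so one of them can be discarded. Hence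
  the parts \<open>A\<close>, \<open>B\<close>, \<open>C\<close> may be assumed to be cliques. Then every vertex of \<open>B\<close> has at most one
  neighbour in \<open>A\<close>, and likewise for \<open>C\<close> in \<open>B\<close> and \<open>A\<close> in \<open>C\<close>. The heaviest vertices
  \<open>a\<close>, \<open>b\<close>, \<open>c\<close> of the three parts do not form a triangle, and a case distinction on how many of
  the pairs among them are edges reduces the bound to three polynomial inequalities.
\<close>

subsection \<open>Clique parts\<close>

text \<open>If two vertices of a clique part had a common neighbour in the next part, the three
  would form a bad triangle. \<open>uniq\<close> records this in the cyclic order \<open>A\<close>,
  \<open>B\<close>, \<open>C\<close>, so that \<open>r\<close> need only be inspected between
  different parts.\<close>

locale clique_parts =
  fixes A B C :: "'b set" and r :: "'b \<Rightarrow> 'b \<Rightarrow> bool" and w :: "'b \<Rightarrow> real"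
  assumes fin: "finite A" "finite B" "finite C"
    and nonneg: "\<And>x. w x \<ge> 0"
    and total: "sum w A = 1" "sum w B = 1" "sum w C = 1"
    and sym: "\<And>x y. r x y \<Longrightarrow> r y x"
    and uniq: "\<And>x y z. x \<in> A \<Longrightarrow> y \<in> A \<Longrightarrow> z \<in> B \<Longrightarrow> r x z \<Longrightarrow> r y z \<Longrightarrow> x = y"
              "\<And>x y z. x \<in> B \<Longrightarrow> y \<in> B \<Longrightarrow> z \<in> C \<Longrightarrow> r x z \<Longrightarrow> r y z \<Longrightarrow> x = y"
              "\<And>x y z. x \<in> C \<Longrightarrow> y \<in> C \<Longrightarrow> z \<in> A \<Longrightarrow> r x z \<Longrightarrow> r y z \<Longrightarrow> x = y"
    and no_transversal: "\<And>x y z. x \<in> A \<Longrightarrow> y \<in> B \<Longrightarrow> z \<in> C \<Longrightarrow> r x y \<Longrightarrow> r y z \<Longrightarrow> r z x \<Longrightarrow> False"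

text \<open>The hypotheses are cyclically symmetric, so a bound proved for one position of the parts
  transfers to the other two.\<close>

lemma (in clique_parts) rotate: "clique_parts B C A r w"
  by unfold_locales
    (use fin nonneg total sym uniq no_transversal in \<open>blast+\<close>)

section \<open>Neighbour weights and heaviest vertices\<close>

definition nbr_weight :: "('b \<Rightarrow> 'b \<Rightarrow> bool) \<Rightarrow> ('b \<Rightarrow> real) \<Rightarrow> 'b set \<Rightarrow> 'b \<Rightarrow> real" where
  "nbr_weight r w S x = (\<Sum>y\<in>S. w y * of_bool (r y x))"

definition is_top :: "('b \<Rightarrow> real) \<Rightarrow> 'b set \<Rightarrow> 'b \<Rightarrow> bool" where
  "is_top w S t \<longleftrightarrow> t \<in> S \<and> (\<forall>y\<in>S. w y \<le> w t)"

text \<open>At most one indicator in the sum is nonzero, which leaves either nothing or the weight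
  of a single neighbour.\<close>

lemma nbr_weight_cases:
  assumes "finite S" and "\<And>y z. y \<in> S \<Longrightarrow> z \<in> S \<Longrightarrow> r y x \<Longrightarrow> r z x \<Longrightarrow> y = z"
  obtains "nbr_weight r w S x = 0" "\<And>y. y \<in> S \<Longrightarrow> \<not> r y x"
  | y where "y \<in> S" "r y x" "nbr_weight r w S x = w y"
proof (cases "\<exists>y\<in>S. r y x")
  case False
  then show ?thesis using that(1) by (auto simp: nbr_weight_def)
next
  case True
  then obtain y where y: "y \<in> S" "r y x" by blast
  have "nbr_weight r w S x = (\<Sum>z\<in>S. if z = y then w y else 0)"
    unfolding nbr_weight_def by (rule sum.cong) (use assms(2) y in auto)
  also have "\<dots> = w y" using assms(1) y by simp
  finally show ?thesis using that(2) y by blast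
qed

lemma nbr_weight_le_top:
  assumes "finite S" and "\<And>y z. y \<in> S \<Longrightarrow> z \<in> S \<Longrightarrow> r y x \<Longrightarrow> r z x \<Longrightarrow> y = z"
    and "is_top w S t" and "\<And>y. w y \<ge> 0"
  shows "nbr_weight r w S x \<le> w t"
  by (rule nbr_weight_cases[of S r x w]) (use assms in \<open>auto simp: is_top_def\<close>)

text \<open>As \<open>t\<close> is not a neighbour of \<open>x\<close>, it differs from the only
  possible neighbour of \<open>x\<close> in \<open>S\<close>, so both squares are separate terms of
  the sum.\<close>

lemma nbr_weight_squares:
  assumes "finite S" and "\<And>y z. y \<in> S \<Longrightarrow> z \<in> S \<Longrightarrow> r y x \<Longrightarrow> r z x \<Longrightarrow> y = z"
    and "t \<in> S" and "\<not> r t x"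
  shows "(w t)\<^sup>2 + (nbr_weight r w S x)\<^sup>2 \<le> (\<Sum>y\<in>S. (w y)\<^sup>2)"
proof -
  consider "nbr_weight r w S x = 0" | y where "y \<in> S" "r y x" "nbr_weight r w S x = w y"
    by (rule nbr_weight_cases[of S r x w]) (use assms in auto)
  then show ?thesis
  proof cases
    case 1
    have "(\<Sum>y\<in>{t}. (w y)\<^sup>2) \<le> (\<Sum>y\<in>S. (w y)\<^sup>2)"
      by (rule sum_mono2) (use assms in auto)
    with 1 show ?thesis by simp
  next
    case (2 y)
    with assms have "y \<noteq> t" by auto
    have "(\<Sum>y\<in>{t,y}. (w y)\<^sup>2) \<le> (\<Sum>y\<in>S. (w y)\<^sup>2)"
      by (rule sum_mono2) (use assms 2 in auto)
    with 2 \<open>y \<noteq> t\<close> show ?thesis by simp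
  qed
qed

lemma top_square_le:
  assumes "finite S" and "is_top w S t"
  shows "(w t)\<^sup>2 \<le> (\<Sum>y\<in>S. (w y)\<^sup>2)"
  using assms sum_mono2[of S "{t}" "\<lambda>y. (w y)\<^sup>2"] by (auto simp: is_top_def)

lemma nbr_weight_nonneg: "(\<And>y. w y \<ge> 0) \<Longrightarrow> nbr_weight r w S x \<ge> 0"
  unfolding nbr_weight_def by (intro sum_nonneg) auto

text \<open>The left side is an average of \<open>f\<close>, hence \<open>M\<close> minus the
  average deficit \<open>M - f x\<close>. All deficits are nonnegative, so those in \<open>U\<close>
  alone give a valid bound.\<close>

lemma weighted_sum_le_loss:
  fixes w f :: "'b \<Rightarrow> real"
  assumes "finite S" "sum w S = 1" "\<And>x. w x \<ge> 0" "\<And>x. x \<in> S \<Longrightarrow> f x \<le> M" "U \<subseteq> S"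
  shows "(\<Sum>x\<in>S. w x * f x) \<le> M - (\<Sum>x\<in>U. w x * (M - f x))"
proof -
  have "(\<Sum>x\<in>U. w x * (M - f x)) \<le> (\<Sum>x\<in>S. w x * (M - f x))"
    by (rule sum_mono2) (use assms in auto)
  also have "\<dots> = M * sum w S - (\<Sum>x\<in>S. w x * f x)"
    by (simp add: right_diff_distrib sum_subtractf sum_distrib_left mult.commute)
  finally show ?thesis using assms by simp
qed

section \<open>The excess, by the edges among the heaviest vertices\<close>

context clique_parts begin

text \<open>When the parts are cliques, the quadratic form equals \<open>3 + 2 * excess\<close>.\<close>

definition "excess = (\<Sum>x\<in>B. w x * nbr_weight r w A x) + (\<Sum>x\<in>C. w x * nbr_weight r w B x)
   + (\<Sum>x\<in>A. w x * nbr_weight r w C x)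
   - ((\<Sum>x\<in>A. (w x)\<^sup>2) + (\<Sum>x\<in>B. (w x)\<^sup>2) + (\<Sum>x\<in>C. (w x)\<^sup>2)) / 2"

context
  fixes a b c
  assumes top: "is_top w A a" "is_top w B b" "is_top w C c"
begin

lemma in_parts: "a \<in> A" "b \<in> B" "c \<in> C"
  using top by (auto simp: is_top_def)

lemma top_le_1: "w a \<le> 1" "w b \<le> 1" "w c \<le> 1"
  using member_le_sum[of a A w] member_le_sum[of b B w] member_le_sum[of c C w]
    in_parts nonneg fin total by auto

lemma nbr_le: "x \<in> B \<Longrightarrow> nbr_weight r w A x \<le> w a" "x \<in> C \<Longrightarrow> nbr_weight r w B x \<le> w b"
   "x \<in> A \<Longrightarrow> nbr_weight r w C x \<le> w c"
  using nbr_weight_le_top[of A r x w a] nbr_weight_le_top[of B r x w b] nbr_weight_le_top[of C r x w c]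
    fin nonneg top uniq by blast+

lemmas squares =
  top_square_le[OF fin(1) top(1)] top_square_le[OF fin(2) top(2)] top_square_le[OF fin(3) top(3)]

lemmas loss_A = weighted_sum_le_loss[OF fin(1) total(1) nonneg, of "nbr_weight r w C" "w c", OF nbr_le(3)]
lemmas loss_B = weighted_sum_le_loss[OF fin(2) total(2) nonneg, of "nbr_weight r w A" "w a", OF nbr_le(1)]
lemmas loss_C = weighted_sum_le_loss[OF fin(3) total(3) nonneg, of "nbr_weight r w B" "w b", OF nbr_le(2)]

lemma squares_A: "x \<in> B \<Longrightarrow> \<not> r a x \<Longrightarrow> (w a)\<^sup>2 + (nbr_weight r w A x)\<^sup>2 \<le> (\<Sum>y\<in>A. (w y)\<^sup>2)"
  and squares_B: "x \<in> C \<Longrightarrow> \<not> r b x \<Longrightarrow> (w b)\<^sup>2 + (nbr_weight r w B x)\<^sup>2 \<le> (\<Sum>y\<in>B. (w y)\<^sup>2)"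
  and squares_C: "x \<in> A \<Longrightarrow> \<not> r c x \<Longrightarrow> (w c)\<^sup>2 + (nbr_weight r w C x)\<^sup>2 \<le> (\<Sum>y\<in>C. (w y)\<^sup>2)"
  using nbr_weight_squares[of A r x a w] nbr_weight_squares[of B r x b w] nbr_weight_squares[of C r x c w]
    in_parts uniq fin by blast+

text \<open>Each of \<open>b\<close>, \<open>c\<close>, \<open>a\<close> sees a weight
  \<open>x\<close>, \<open>y\<close>, \<open>z\<close> in the cyclically preceding part. By the
  missing edges this weight does not come from the heaviest vertex there, so every sum of squares
  has two known terms, and each heaviest vertex gives a loss.\<close>

lemma excess_le_no_edge:
  assumes "\<not> r a b" "\<not> r b c" "\<not> r c a"
  shows "excess \<le> 1"
proof -
  define \<alpha> \<beta> \<gamma> where "\<alpha> = w a" "\<beta> = w b" "\<gamma> = w c"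
  define x y z where "x = nbr_weight r w A b" "y = nbr_weight r w B c" "z = nbr_weight r w C a"
  note defs = \<alpha>_\<beta>_\<gamma>_def x_y_z_def
  have q: "\<alpha>\<^sup>2 + x\<^sup>2 \<le> (\<Sum>y\<in>A. (w y)\<^sup>2)" "\<beta>\<^sup>2 + y\<^sup>2 \<le> (\<Sum>y\<in>B. (w y)\<^sup>2)"
     "\<gamma>\<^sup>2 + z\<^sup>2 \<le> (\<Sum>y\<in>C. (w y)\<^sup>2)"
    using squares_A squares_B squares_C assms in_parts unfolding defs by blast+
  have l: "(\<Sum>x\<in>A. w x * nbr_weight r w C x) \<le> \<gamma> - \<alpha> * (\<gamma> - z)"
    "(\<Sum>x\<in>B. w x * nbr_weight r w A x) \<le> \<alpha> - \<beta> * (\<alpha> - x)"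
    "(\<Sum>x\<in>C. w x * nbr_weight r w B x) \<le> \<beta> - \<gamma> * (\<beta> - y)"
    using loss_A[of "{a}"] loss_B[of "{b}"] loss_C[of "{c}"] in_parts unfolding defs by auto
  have bounds: "0 \<le> \<alpha>" "0 \<le> \<beta>" "0 \<le> \<gamma>" "0 \<le> 1 - \<alpha>" "0 \<le> 1 - \<beta>" "0 \<le> 1 - \<gamma>"
    using nonneg top_le_1 unfolding defs by auto
  \<comment> \<open>the squares come from minimising over \<open>x\<close>, \<open>y\<close>, \<open>z\<close>\<close>
  have "0 \<le> (z - \<alpha>)\<^sup>2 / 2 + (x - \<beta>)\<^sup>2 / 2 + (y - \<gamma>)\<^sup>2 / 2
      + (1 - \<alpha>) * (1 - \<beta>) * (1 - \<gamma>) + \<alpha> * \<beta> * \<gamma>"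
    using bounds by (intro add_nonneg_nonneg mult_nonneg_nonneg) auto
  also have "\<dots> = 1 - ((\<gamma> - \<alpha> * (\<gamma> - z)) + (\<alpha> - \<beta> * (\<alpha> - x)) + (\<beta> - \<gamma> * (\<beta> - y))
      - ((\<alpha>\<^sup>2 + x\<^sup>2) + (\<beta>\<^sup>2 + y\<^sup>2) + (\<gamma>\<^sup>2 + z\<^sup>2)) / 2)"
    by (simp add: power2_eq_square field_simps)
  finally show ?thesis unfolding excess_def using q l by argo
qed

text \<open>Since \<open>c\<close> is adjacent to \<open>b\<close> and there is no transversal
  triangle, a neighbour of \<open>b\<close> in \<open>A\<close> is not adjacent to \<open>c\<close>.
  It therefore gives a loss against \<open>w c\<close>, and what it sees in \<open>C\<close> adds a
  second square.\<close>

lemma excess_le_two_edges: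
  assumes "r c a" "r b c" "\<not> r a b"
  shows "excess \<le> 1"
proof -
  define \<alpha> \<beta> \<gamma> where "\<alpha> = w a" "\<beta> = w b" "\<gamma> = w c"
  define x where "x = nbr_weight r w A b"
  note defs = \<alpha>_\<beta>_\<gamma>_def x_def
  have x: "0 \<le> x" "x \<le> \<alpha>"
    unfolding defs using nbr_weight_nonneg[OF nonneg] nbr_le in_parts by auto
  have qA: "\<alpha>\<^sup>2 + x\<^sup>2 \<le> (\<Sum>y\<in>A. (w y)\<^sup>2)"
    using squares_A assms in_parts unfolding defs by blast
  have qB: "\<beta>\<^sup>2 \<le> (\<Sum>y\<in>B. (w y)\<^sup>2)" using squares unfolding defs by blast
  have lB: "(\<Sum>x\<in>B. w x * nbr_weight r w A x) \<le> \<alpha> - \<beta> * (\<alpha> - x)"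
    using loss_B[of "{b}"] in_parts unfolding defs by auto
  have lC: "(\<Sum>x\<in>C. w x * nbr_weight r w B x) \<le> \<beta>"
    using loss_C[of "{}"] in_parts unfolding defs by auto
  \<comment> \<open>Here \<open>y\<close> is the weight that the neighbour of \<open>b\<close> in
    \<open>A\<close> sees in \<open>C\<close>. If \<open>b\<close> has no neighbour in
    \<open>A\<close>, then \<open>x = 0\<close> and \<open>y = 0\<close> serves.\<close>
  obtain y where y: "\<gamma>\<^sup>2 + y\<^sup>2 \<le> (\<Sum>y\<in>C. (w y)\<^sup>2)"
      "(\<Sum>x\<in>A. w x * nbr_weight r w C x) \<le> \<gamma> - x * (\<gamma> - y)"
  proof (rule nbr_weight_cases[of A r b w])
    assume "nbr_weight r w A b = 0"
    then show ?thesis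
      using that[of 0] squares loss_A[of "{}"] unfolding defs by auto
  next
    fix a' assume a': "a' \<in> A" "r a' b" "nbr_weight r w A b = w a'"
    then have "\<not> r c a'" using no_transversal assms in_parts sym by blast
    then have "\<gamma>\<^sup>2 + (nbr_weight r w C a')\<^sup>2 \<le> (\<Sum>y\<in>C. (w y)\<^sup>2)"
      using squares_C a' unfolding defs by blast
    moreover have "(\<Sum>x\<in>A. w x * nbr_weight r w C x) \<le> \<gamma> - x * (\<gamma> - nbr_weight r w C a')"
      using loss_A[of "{a'}"] a' unfolding defs by auto
    ultimately show ?thesis by (rule that)
  qed (use fin uniq in_parts in auto)
  \<comment> \<open>the squares come from minimising over \<open>y\<close>, then \<open>\<beta>\<close>, then \<open>\<gamma>\<close>\<close>
  have "0 \<le> (y - x)\<^sup>2 / 2 + (\<beta> - (1 + x - \<alpha>))\<^sup>2 / 2 + (\<gamma> - (1 - x))\<^sup>2 / 2 + x * (\<alpha> - x)"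
    using x by (intro add_nonneg_nonneg mult_nonneg_nonneg) auto
  also have "\<dots> = 1 - ((\<gamma> - x * (\<gamma> - y)) + (\<alpha> - \<beta> * (\<alpha> - x)) + \<beta>
      - ((\<alpha>\<^sup>2 + x\<^sup>2) + \<beta>\<^sup>2 + (\<gamma>\<^sup>2 + y\<^sup>2)) / 2)"
    by (simp add: power2_eq_square field_simps)
  finally show ?thesis unfolding excess_def using qA qB lB lC y by argo
qed

text \<open>A neighbour \<open>b'\<close> of \<open>c\<close> in \<open>B\<close> differs from
  \<open>b\<close> and, as there is no transversal triangle, is not adjacent to \<open>a\<close>.
  Thus both \<open>b\<close> and \<open>b'\<close> miss the heaviest vertex of \<open>A\<close>, and
  both give a loss in the sum over \<open>B\<close>.\<close>

lemma excess_le_one_edge: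
  assumes "r c a" "\<not> r b c" "\<not> r a b"
  shows "excess \<le> 1"
proof -
  define \<alpha> \<beta> \<gamma> where "\<alpha> = w a" "\<beta> = w b" "\<gamma> = w c"
  define y where "y = nbr_weight r w B c"
  note defs = \<alpha>_\<beta>_\<gamma>_def y_def
  have y: "0 \<le> y" "y \<le> \<beta>"
    unfolding defs using nbr_weight_nonneg[OF nonneg] nbr_le in_parts by auto
  have qB: "\<beta>\<^sup>2 + y\<^sup>2 \<le> (\<Sum>y\<in>B. (w y)\<^sup>2)"
    using squares_B assms in_parts unfolding defs by blast
  have qC: "\<gamma>\<^sup>2 \<le> (\<Sum>y\<in>C. (w y)\<^sup>2)" using squares unfolding defs by blast
  have lC: "(\<Sum>x\<in>C. w x * nbr_weight r w B x) \<le> \<beta> - \<gamma> * (\<beta> - y)"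
    using loss_C[of "{c}"] in_parts unfolding defs by auto
  have lA: "(\<Sum>x\<in>A. w x * nbr_weight r w C x) \<le> \<gamma>"
    using loss_A[of "{}"] in_parts unfolding defs by auto
  have bounds: "0 \<le> \<beta>" "\<beta> \<le> 1"
    using nonneg top_le_1 unfolding defs by auto
  \<comment> \<open>One \<open>x\<close> serves for \<open>b\<close> and \<open>b'\<close> together,
    with loss factor \<open>\<beta> + y\<close>. If \<open>c\<close> has no neighbour in
    \<open>B\<close>, then \<open>y = 0\<close> and \<open>b\<close> alone suffices.\<close>
  obtain x where x: "x \<le> \<alpha>" "\<alpha>\<^sup>2 + x\<^sup>2 \<le> (\<Sum>y\<in>A. (w y)\<^sup>2)"
      "(\<Sum>x\<in>B. w x * nbr_weight r w A x) \<le> \<alpha> - (\<beta> + y) * (\<alpha> - x)"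
  proof (rule nbr_weight_cases[of B r c w])
    assume "nbr_weight r w B c = 0"
    then show ?thesis
      using that[of "nbr_weight r w A b"] squares_A[of b] assms in_parts nbr_le(1) loss_B[of "{b}"]
      unfolding defs by auto
  next
    fix b' assume b': "b' \<in> B" "r b' c" "nbr_weight r w B c = w b'"
    then have n: "\<not> r a b'" "b' \<noteq> b" using no_transversal assms in_parts sym by blast+
    \<comment> \<open>The bound on squares holds for both weights, hence for the larger one, and the
      larger one only weakens the loss.\<close>
    define x where "x = max (nbr_weight r w A b) (nbr_weight r w A b')"
    have "x \<le> \<alpha>" using nbr_le b' in_parts unfolding defs x_def by auto
    moreover have "\<alpha>\<^sup>2 + x\<^sup>2 \<le> (\<Sum>y\<in>A. (w y)\<^sup>2)"
      using squares_A[of b] squares_A[of b'] assms n b' in_parts unfolding defs x_def max_def by auto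
    moreover have "(\<Sum>x\<in>B. w x * nbr_weight r w A x) \<le> \<alpha> - (\<beta> + y) * (\<alpha> - x)"
    proof -
      have "(\<Sum>x\<in>B. w x * nbr_weight r w A x) \<le>
          \<alpha> - (\<beta> * (\<alpha> - nbr_weight r w A b) + y * (\<alpha> - nbr_weight r w A b'))"
        using loss_B[of "{b,b'}"] b' n in_parts unfolding defs by auto
      also have "\<dots> \<le> \<alpha> - (\<beta> * (\<alpha> - x) + y * (\<alpha> - x))"
        using y bounds by (intro diff_left_mono add_mono mult_left_mono) (auto simp: x_def)
      finally show ?thesis by (simp add: algebra_simps)
    qed
    ultimately show ?thesis by (rule that)
  qed (use fin uniq in_parts in auto)
  define u d where "u = \<beta> + y" "d = \<alpha> - x"
  have d: "d \<ge> 0" using x by (simp add: u_d_def)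
  \<comment> \<open>This remains of the claim after minimising over \<open>\<gamma>\<close>, and
    over \<open>\<alpha> + x\<close> with \<open>d\<close> fixed.\<close>
  have key: "y * (1 - \<beta>) \<le> u * d + (1 - d)\<^sup>2 / 4"
  \<comment> \<open>For \<open>d \<ge> 0\<close> the right side is least at
    \<open>d = 1 - 2 * u\<close> if \<open>u \<le> 1 / 2\<close>, with value
    \<open>u * (1 - u)\<close>, and otherwise at \<open>d = 0\<close>, with value
    \<open>1 / 4\<close>.\<close>
  proof (cases "u \<le> 1 / 2")
    case True
    have "y * (1 - \<beta>) = u * (1 - u) - (\<beta> - u * u) - \<beta> * y"
      by (simp add: u_d_def algebra_simps)
    also have "\<dots> \<le> u * (1 - u)"
    proof -
      have "u * u \<le> 1 / 2 * u" using True y bounds by (intro mult_right_mono) (auto simp: u_d_def)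
      moreover have "u \<le> 2 * \<beta>" "0 \<le> \<beta> * y" using y bounds by (simp_all add: u_d_def)
      ultimately show ?thesis by linarith
    qed
    also have "\<dots> \<le> u * (1 - u) + (1 - d - 2 * u)\<^sup>2 / 4" by simp
    also have "\<dots> = u * d + (1 - d)\<^sup>2 / 4" by (simp add: power2_eq_square field_simps)
    finally show ?thesis .
  next
    case False
    have "y * (1 - \<beta>) \<le> \<beta> * (1 - \<beta>)" using y bounds by (intro mult_right_mono) auto
    also have "\<dots> \<le> \<beta> * (1 - \<beta>) + (\<beta> - 1 / 2)\<^sup>2" by simp
    also have "\<dots> = 1 / 4" by (simp add: power2_eq_square field_simps)
    also have "\<dots> \<le> 1 / 4 + (u - 1 / 2) * d + d\<^sup>2 / 4" using False d by simp
    also have "\<dots> = u * d + (1 - d)\<^sup>2 / 4" by (simp add: power2_eq_square field_simps)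
    finally show ?thesis .
  qed
  \<comment> \<open>The two squares vanish at the minimising values, and the last bracket is the
    slack in \<open>key\<close>.\<close>
  have "0 \<le> (\<gamma> - (1 - (\<beta> - y)))\<^sup>2 / 2 + (1 - \<alpha> - x)\<^sup>2 / 4 + (u * d + (1 - d)\<^sup>2 / 4 - y * (1 - \<beta>))"
    using key by (intro add_nonneg_nonneg mult_nonneg_nonneg) auto
  also have "\<dots> = 1 - (\<gamma> + (\<alpha> - (\<beta> + y) * (\<alpha> - x)) + (\<beta> - \<gamma> * (\<beta> - y))
      - ((\<alpha>\<^sup>2 + x\<^sup>2) + (\<beta>\<^sup>2 + y\<^sup>2) + \<gamma>\<^sup>2) / 2)"
    unfolding u_d_def by (simp add: power2_eq_square field_simps)
  finally show ?thesis unfolding excess_def using qB qC lA lC x by argo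
qed

end

end

text \<open>At most two of the three pairs among the heaviest vertices are edges. Rotating the parts
  brings the only edge, or the only missing one, into the position treated above.\<close>

lemma clique_parts_excess_le:
  assumes "clique_parts A B C r w"
  shows "clique_parts.excess A B C r w \<le> 1"
proof -
  interpret ABC: clique_parts A B C r w by fact
  interpret BCA: clique_parts B C A r w by (rule ABC.rotate)
  interpret CAB: clique_parts C A B r w by (rule BCA.rotate)
  have ex: "\<exists>t. is_top w S t" if "finite S" "sum w S = 1" for S
  proof -
    have "S \<noteq> {}" using that by auto
    with that have "Max (w ` S) \<in> w ` S" by (intro Max_in) auto
    then obtain t where "t \<in> S" "w t = Max (w ` S)" by auto
    with that show ?thesis by (auto simp: is_top_def)
  qed
  from ex[OF ABC.fin(1) ABC.total(1)] ex[OF ABC.fin(2) ABC.total(2)] ex[OF ABC.fin(3) ABC.total(3)]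
  obtain a b c where top: "is_top w A a" "is_top w B b" "is_top w C c"
    by blast
  have eq: "BCA.excess = ABC.excess" "CAB.excess = ABC.excess"
    unfolding ABC.excess_def BCA.excess_def CAB.excess_def by simp_all
  have "\<not> (r a b \<and> r b c \<and> r c a)"
    using ABC.no_transversal top by (auto simp: is_top_def)
  then show ?thesis
    using ABC.excess_le_no_edge[OF top]
      ABC.excess_le_one_edge[OF top] ABC.excess_le_two_edges[OF top]
      BCA.excess_le_one_edge[OF top(2,3,1)] BCA.excess_le_two_edges[OF top(2,3,1)]
      CAB.excess_le_one_edge[OF top(3,1,2)] CAB.excess_le_two_edges[OF top(3,1,2)]
    unfolding eq by argo
qed

subsection \<open>Shifting weights\<close>

definition form :: "'b set \<Rightarrow> ('b \<Rightarrow> 'b \<Rightarrow> bool) \<Rightarrow> ('b \<Rightarrow> real) \<Rightarrow> real" where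
  "form V r w = (\<Sum>x\<in>V. \<Sum>y\<in>V. w x * w y * of_bool (r x y))"

lemma form_Un:
  assumes "finite S" "finite T" "S \<inter> T = {}" "\<And>x y. r x y \<Longrightarrow> r y x"
  shows "form (S \<union> T) r w = form S r w + form T r w + 2 * (\<Sum>x\<in>T. w x * nbr_weight r w S x)"
proof -
  have sym: "of_bool (r x y) = (of_bool (r y x) :: real)" for x y using assms(4) by auto
  have 1: "(\<Sum>x\<in>S. \<Sum>y\<in>T. w x * w y * of_bool (r x y)) = (\<Sum>x\<in>T. w x * nbr_weight r w S x)"
    unfolding nbr_weight_def sum_distrib_left
    by (subst sum.swap) (auto intro!: sum.cong simp: mult_ac)
  have 2: "(\<Sum>x\<in>T. \<Sum>y\<in>S. w x * w y * of_bool (r x y)) = (\<Sum>x\<in>T. w x * nbr_weight r w S x)"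
    unfolding nbr_weight_def sum_distrib_left using assms(4)
    by (intro sum.cong refl) (auto simp: mult_ac)
  show ?thesis
    unfolding form_def sum.union_disjoint[OF assms(1-3)] sum.distrib 1 2 by simp
qed

text \<open>Without loops the form is affine in the weight of a single vertex, which is what makes
  the shift of weights work.\<close>

lemma form_insert:
  assumes "finite S" "u \<notin> S" "\<And>x y. r x y \<Longrightarrow> r y x" "\<And>x. \<not> r x x"
  shows "form (insert u S) r w = form S r w + 2 * w u * nbr_weight r w S u"
  using form_Un[of S "{u}" r w] assms by (simp add: form_def)

text \<open>The square of the total weight runs over all ordered pairs, and a clique lacks only the
  diagonal ones.\<close>

lemma form_clique:
  assumes "finite S" "sum w S = 1" "\<And>x. \<not> r x x"
    "\<And>x y. x \<in> S \<Longrightarrow> y \<in> S \<Longrightarrow> x \<noteq> y \<Longrightarrow> r x y"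
  shows "form S r w = 1 - (\<Sum>x\<in>S. (w x)\<^sup>2)"
proof -
  have "form S r w = (\<Sum>x\<in>S. \<Sum>y\<in>S. w x * w y - (if y = x then (w x)\<^sup>2 else 0))"
    unfolding form_def by (intro sum.cong refl) (use assms in \<open>auto simp: power2_eq_square\<close>)
  also have "\<dots> = sum w S * sum w S - (\<Sum>x\<in>S. (w x)\<^sup>2)"
    using assms(1) by (simp add: sum_subtractf sum_product)
  finally show ?thesis using assms(2) by simp
qed

definition bad_types :: "(nat \<times> nat \<times> nat) set" where
  "bad_types = {(1, 2, 3), (1, 1, 2), (2, 2, 3), (3, 3, 1)}"

text \<open>Here \<open>\<kappa> x\<close> is the part of \<open>x\<close>. Induction on the number
  of vertices merges a nonadjacent pair inside a part into one vertex; once no such pair is left,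
  the value is \<open>3 + 2 * excess\<close> with an excess of at most 1.\<close>

lemma form_le_5:
  fixes \<kappa> :: "'b \<Rightarrow> nat"
  assumes "finite V" "\<And>x. w x \<ge> 0" "\<kappa> ` V \<subseteq> {1..3}"
    and "\<And>i. i \<in> {1..3} \<Longrightarrow> (\<Sum>x\<in>V. if \<kappa> x = i then w x else 0) = 1"
    and "\<And>x y. r x y \<Longrightarrow> r y x" "\<And>x. \<not> r x x"
    and "\<And>x y z. x \<in> V \<Longrightarrow> y \<in> V \<Longrightarrow> z \<in> V \<Longrightarrow> r x y \<Longrightarrow> r y z \<Longrightarrow> r x z \<Longrightarrow>
      (\<kappa> x, \<kappa> y, \<kappa> z) \<notin> bad_types"
  shows "form V r w \<le> 5"
  using assms
proof (induction "card V" arbitrary: V w rule: less_induct)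
  case less
  note sym = less.prems(5) and irrefl = less.prems(6) and no_bad = less.prems(7)
  show ?case
  proof (cases "\<exists>u\<in>V. \<exists>v\<in>V. u \<noteq> v \<and> \<kappa> u = \<kappa> v \<and> \<not> r u v")
    case True
    define nb where "nb u v = nbr_weight r w (V - {u,v}) u" for u v
    \<comment> \<open>The pair is named so that \<open>u\<close> sees at least as much weight
      outside the pair as \<open>v\<close>.\<close>
    obtain u v where uv: "u \<in> V" "v \<in> V" "u \<noteq> v" "\<kappa> u = \<kappa> v" "\<not> r u v" "nb v u \<le> nb u v"
    proof -
      from True obtain u v where "u \<in> V" "v \<in> V" "u \<noteq> v" "\<kappa> u = \<kappa> v" "\<not> r u v" by blast
      with that[of u v] that[of v u] sym show ?thesis by fastforce
    qed
    define W where "W = V - {u,v}"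
    \<comment> \<open>The weight of \<open>v\<close> moves to \<open>u\<close> in the same part, so
      all part totals stay 1. As \<open>u\<close> and \<open>v\<close> are nonadjacent, the form
      contains no product \<open>w u * w v\<close>.\<close>
    define w' where "w' = w(u := w u + w v)"
    have W: "finite W" "u \<notin> W" "v \<notin> insert u W" "V = insert v (insert u W)"
      using less.prems(1) uv by (auto simp: W_def)
    have eqf: "form W r w' = form W r w" "nbr_weight r w' W u = nbr_weight r w W u"
      unfolding form_def nbr_weight_def w'_def
      by (intro sum.cong refl; use W in auto)+
    have nb_eq: "nb u v = nbr_weight r w W u" "nb v u = nbr_weight r w W v"
      by (simp_all add: nb_def W_def insert_commute)
    have "nbr_weight r w (insert u W) v = nbr_weight r w W v"
      using W uv by (simp add: nbr_weight_def)
    then have "form V r w = form W r w + 2 * w u * nbr_weight r w W u + 2 * w v * nbr_weight r w W v"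
      using W form_insert[of "insert u W" v r w] form_insert[of W u r w] sym irrefl by auto
    also have "\<dots> \<le> form W r w + 2 * w u * nbr_weight r w W u + 2 * w v * nbr_weight r w W u"
      using uv(6) less.prems(2) unfolding nb_eq by (intro add_left_mono mult_left_mono) auto
    also have "\<dots> = form (insert u W) r w'"
      using W form_insert[of W u r w'] sym irrefl eqf by (auto simp: w'_def algebra_simps)
    also have "\<dots> \<le> 5"
    proof (rule less.hyps)
      show "(\<Sum>x\<in>insert u W. if \<kappa> x = i then w' x else 0) = 1" if "i \<in> {1..3}" for i
      proof -
        have "(\<Sum>x\<in>W. if \<kappa> x = i then w' x else 0) = (\<Sum>x\<in>W. if \<kappa> x = i then w x else 0)"
          by (intro sum.cong refl) (use W in \<open>auto simp: w'_def\<close>)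
        then show ?thesis
          using less.prems(4)[OF that] W uv by (simp add: w'_def split: if_splits)
      qed
      show "(\<kappa> x, \<kappa> y, \<kappa> z) \<notin> bad_types"
        if "x \<in> insert u W" "y \<in> insert u W" "z \<in> insert u W" "r x y" "r y z" "r x z" for x y z
        using no_bad[of x y z] that W by blast
    qed (use less.prems W sym irrefl in \<open>auto simp: w'_def\<close>)
    finally show ?thesis .
  next
    case False
    define S where "S i = {x\<in>V. \<kappa> x = i}" for i
    have fin: "finite (S i)" for i using less.prems(1) by (simp add: S_def)
    have clique: "r x y" if "x \<in> S i" "y \<in> S i" "x \<noteq> y" for x y i
      proof -
      from that have "x \<in> V" "y \<in> V" "\<kappa> x = \<kappa> y" by (simp_all add: S_def)
      with False that(3) show ?thesis by blast
    qed
    have total: "sum w (S i) = 1" if "i \<in> {1..3}" for i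
      using less.prems(4)[OF that] less.prems(1) unfolding S_def by (simp add: sum.inter_filter)
    have bad: False if "x \<in> S i" "y \<in> S j" "z \<in> S k" "r x y" "r y z" "r x z" "(i, j, k) \<in> bad_types"
      for x y z i j k
      using no_bad[of x y z] that by (auto simp: S_def)
    have uniq: "x = y" if "x \<in> S i" "y \<in> S i" "z \<in> S k" "r x z" "r y z" "(i, i, k) \<in> bad_types" for x y z i k
    proof (rule ccontr)
      assume "x \<noteq> y"
      from bad[OF that(1-3) clique[OF that(1,2) this] that(5,4,6)] show False .
    qed
    interpret clique_parts "S 1" "S 2" "S 3" r w
    proof
      show "x = y" if "x \<in> S 1" "y \<in> S 1" "z \<in> S 2" "r x z" "r y z" for x y z
        using uniq that by (auto simp: bad_types_def)
      show "x = y" if "x \<in> S 2" "y \<in> S 2" "z \<in> S 3" "r x z" "r y z" for x y z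
        using uniq that by (auto simp: bad_types_def)
      show "x = y" if "x \<in> S 3" "y \<in> S 3" "z \<in> S 1" "r x z" "r y z" for x y z
        using uniq that by (auto simp: bad_types_def)
      show False if "x \<in> S 1" "y \<in> S 2" "z \<in> S 3" "r x y" "r y z" "r z x" for x y z
        using bad[of x 1 y 2 z 3] that sym by (auto simp: bad_types_def)
    qed (use fin total less.prems(2) sym in auto)
    have V: "V = (S 1 \<union> S 2) \<union> S 3"
      using less.prems(3) by (force simp: S_def)
    have disj: "S 1 \<inter> S 2 = {}" "(S 1 \<union> S 2) \<inter> S 3 = {}" "S 1 \<inter> S 3 = {}"
      by (auto simp: S_def)
    have "nbr_weight r w (S 1 \<union> S 2) x = nbr_weight r w (S 1) x + nbr_weight r w (S 2) x" for x
      unfolding nbr_weight_def using fin disj by (intro sum.union_disjoint) auto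
    then have cross: "(\<Sum>x\<in>S 3. w x * nbr_weight r w (S 1 \<union> S 2) x) =
        (\<Sum>x\<in>S 3. w x * nbr_weight r w (S 1) x) + (\<Sum>x\<in>S 3. w x * nbr_weight r w (S 2) x)"
      by (simp add: distrib_left sum.distrib)
    \<comment> \<open>\<open>form_Un\<close> yields the sum over \<open>S 3\<close>, whereas
      \<open>excess\<close> has the one over \<open>S 1\<close>; expanding the union in both orders
      identifies them.\<close>
    have swap: "(\<Sum>x\<in>S 3. w x * nbr_weight r w (S 1) x) = (\<Sum>x\<in>S 1. w x * nbr_weight r w (S 3) x)"
    proof -
      have "form (S 1 \<union> S 3) r w = form (S 3 \<union> S 1) r w" by (simp add: Un_commute)
      then show ?thesis
        using form_Un[of "S 1" "S 3" r w] form_Un[of "S 3" "S 1" r w] fin disj sym by auto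
    qed
    have fc: "form (S 1) r w = 1 - (\<Sum>x\<in>S 1. (w x)\<^sup>2)" "form (S 2) r w = 1 - (\<Sum>x\<in>S 2. (w x)\<^sup>2)"
      "form (S 3) r w = 1 - (\<Sum>x\<in>S 3. (w x)\<^sup>2)"
      using fin total clique irrefl by (auto intro!: form_clique)
    have "form V r w = form (S 1) r w + form (S 2) r w + 2 * (\<Sum>x\<in>S 2. w x * nbr_weight r w (S 1) x)
        + form (S 3) r w + 2 * (\<Sum>x\<in>S 3. w x * nbr_weight r w (S 1 \<union> S 2) x)"
      unfolding V using form_Un[of "S 1 \<union> S 2" "S 3" r w] form_Un[of "S 1" "S 2" r w] fin disj sym by auto
    also have "\<dots> = 3 + 2 * excess"
      unfolding excess_def cross swap fc by (simp add: field_simps)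
    also have "\<dots> \<le> 5"
      using clique_parts_excess_le[OF clique_parts_axioms] by simp
    finally show ?thesis .
  qed
qed

subsection \<open>Sampling\<close>

text \<open>The factor \<open>p\<close> stands for a division of \<open>k\<close> by
  \<open>p\<close>, so that fibres of equal size are summed within the natural numbers.\<close>

lemma card_fibres:
  assumes "finite D" "finite X" "\<And>t. t \<in> X \<Longrightarrow> card {x\<in>D. g x = t} * p = k"
  shows "card {x\<in>D. g x \<in> X} * p = card X * k"
proof -
  have "{x\<in>D. g x \<in> X} = (\<Union>t\<in>X. {x\<in>D. g x = t})" by auto
  also have "card \<dots> = (\<Sum>t\<in>X. card {x\<in>D. g x = t})"
    using assms by (intro card_UN_disjoint) auto
  finally show ?thesis using assms by (simp add: sum_distrib_right)
qed

text \<open>Prescribed values turn the factors at \<open>J\<close> into singletons, so the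
  cardinality of the product loses exactly these factors.\<close>

lemma card_PiE_fixed:
  assumes "finite I" "J \<subseteq> I" "\<And>i. i \<in> J \<Longrightarrow> a i \<in> S i"
  shows "card {\<phi> \<in> PiE I S. \<forall>i\<in>J. \<phi> i = a i} * (\<Prod>i\<in>J. card (S i)) = card (PiE I S)"
proof -
  have "{\<phi> \<in> PiE I S. \<forall>i\<in>J. \<phi> i = a i} = PiE I (\<lambda>i. if i \<in> J then {a i} else S i)"
    using assms by (auto simp: PiE_iff extensional_def split: if_splits)
  then have "card {\<phi> \<in> PiE I S. \<forall>i\<in>J. \<phi> i = a i} = (\<Prod>i\<in>I. card (if i \<in> J then {a i} else S i))"
    using assms by (simp add: card_PiE)
  also have "\<dots> = (\<Prod>i\<in>I. if i \<in> J then 1 else card (S i))"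
    by (intro prod.cong) auto
  also have "\<dots> = (\<Prod>i\<in>I - J. card (S i))"
    using assms by (simp add: prod.If_cases Diff_eq)
  finally show ?thesis
    using assms by (simp add: card_PiE prod.subset_diff[of J I])
qed

text \<open>For uniformly random \<open>\<phi>\<close> the values at two distinct labels are
  independent and uniform; this is that fact with denominators cleared.\<close>

lemma card_PiE_pair:
  assumes "finite I" "\<And>i. i \<in> I \<Longrightarrow> finite (S i)" "u \<in> I" "v \<in> I" "u \<noteq> v" "X \<subseteq> S u \<times> S v"
  shows "card {\<phi> \<in> PiE I S. (\<phi> u, \<phi> v) \<in> X} * (card (S u) * card (S v)) = card X * card (PiE I S)"
proof (rule card_fibres)
  fix t assume "t \<in> X"
  obtain a b where t: "t = (a, b)" by force
  have "card {\<phi> \<in> PiE I S. \<forall>i\<in>{u,v}. \<phi> i = (if i = u then a else b)}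
      * (\<Prod>i\<in>{u,v}. card (S i)) = card (PiE I S)"
    by (rule card_PiE_fixed) (use assms t \<open>t \<in> X\<close> in auto)
  moreover have "{\<phi> \<in> PiE I S. \<forall>i\<in>{u,v}. \<phi> i = (if i = u then a else b)}
      = {\<phi> \<in> PiE I S. (\<phi> u, \<phi> v) = t}"
    using assms(5) t by auto
  ultimately show "card {\<phi> \<in> PiE I S. (\<phi> u, \<phi> v) = t} * (card (S u) * card (S v)) = card (PiE I S)"
    using assms(5) by simp
qed (use assms in \<open>auto intro: finite_PiE finite_subset[OF assms(6)]\<close>)

lemma card_PiE_triple:
  assumes "finite I" "\<And>i. i \<in> I \<Longrightarrow> finite (S i)" "u \<in> I" "v \<in> I" "x \<in> I"
    and "u \<noteq> v" "v \<noteq> x" "u \<noteq> x" "X \<subseteq> S u \<times> S v \<times> S x"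
  shows "card {\<phi> \<in> PiE I S. (\<phi> u, \<phi> v, \<phi> x) \<in> X} * (card (S u) * card (S v) * card (S x))
    = card X * card (PiE I S)"
proof (rule card_fibres)
  fix t assume "t \<in> X"
  obtain a b c where t: "t = (a, b, c)" by (metis prod.exhaust)
  have "card {\<phi> \<in> PiE I S. \<forall>i\<in>{u,v,x}. \<phi> i = (if i = u then a else if i = v then b else c)}
      * (\<Prod>i\<in>{u,v,x}. card (S i)) = card (PiE I S)"
    by (rule card_PiE_fixed) (use assms t \<open>t \<in> X\<close> in auto)
  moreover have "{\<phi> \<in> PiE I S. \<forall>i\<in>{u,v,x}. \<phi> i = (if i = u then a else if i = v then b else c)}
      = {\<phi> \<in> PiE I S. (\<phi> u, \<phi> v, \<phi> x) = t}"
    using assms t by auto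
  ultimately show "card {\<phi> \<in> PiE I S. (\<phi> u, \<phi> v, \<phi> x) = t} * (card (S u) * card (S v) * card (S x))
      = card (PiE I S)"
    using assms by (simp add: mult_ac)
qed (use assms in \<open>auto intro: finite_PiE finite_subset[OF assms(9)]\<close>)

section \<open>Edge densities and the sampling inequality\<close>

lemma sum_fst_Times: "(\<Sum>t\<in>A \<times> B. f (fst t)) = real (card B) * (\<Sum>x\<in>A. f x)"
proof -
  have "(\<Sum>t\<in>A \<times> B. f (fst t)) = (\<Sum>x\<in>A. \<Sum>y\<in>B. f x)"
    by (subst sum.cartesian_product) (simp add: case_prod_unfold)
  then show ?thesis by (simp add: sum_distrib_left)
qed

text \<open>The triples are ordered to match the values of a sample at three labels;
  \<open>card_bad_triples_le\<close> relates them to the unordered triangles of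
  \<open>rho3\<close>.\<close>

definition bad_triples :: "'a set set \<Rightarrow> (nat \<Rightarrow> 'a set) \<Rightarrow> ('a \<times> 'a \<times> 'a) set" where
  "bad_triples E P = {(a, b, c). {a, b} \<in> E \<and> {b, c} \<in> E \<and> {a, c} \<in> E \<and>
     (\<exists>(i, j, k)\<in>bad_types. a \<in> P i \<and> b \<in> P j \<and> c \<in> P k)}"

text \<open>For \<open>S = T\<close> the whole square is taken, diagonal included, so for three
  disjoint parts of size \<open>n\<close> that cover the graph the nine densities add up to twice
  the number of edges over \<open>n^2\<close>.\<close>

definition pair_density :: "'a set set \<Rightarrow> 'a set \<Rightarrow> 'a set \<Rightarrow> real" where
  "pair_density E S T = card {(a, b) \<in> S \<times> T. {a, b} \<in> E} / (card S * card T)"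

lemma pair_density_le_1:
  assumes "finite S" "finite T"
  shows "pair_density E S T \<le> 1"
proof -
  have "card {(a, b) \<in> S \<times> T. {a, b} \<in> E} \<le> card (S \<times> T)"
    by (rule card_mono) (use assms in auto)
  then have "real (card {(a, b) \<in> S \<times> T. {a, b} \<in> E}) \<le> real (card S * card T)"
    unfolding card_cartesian_product by (rule of_nat_mono)
  then show ?thesis unfolding pair_density_def by (auto simp: divide_le_eq_1 zero_less_mult_iff)
qed

text \<open>Adjacent label pairs are counted over all samples. A sample without bad triangles has at
  most \<open>5 * m^2\<close> of them by \<open>form_le_5\<close>, any other at most
  \<open>9 * m^2\<close>. The term \<open>3 / m\<close> pays for the \<open>3 * m\<close> diagonal
  label pairs, and the last term for the bad samples, where \<open>243 = 9 * 27\<close>.\<close>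

lemma density_sum_le:
  fixes P :: "nat \<Rightarrow> 'a set"
  assumes fin: "\<And>i. i \<in> {1..3} \<Longrightarrow> finite (P i)"
    and E: "\<And>e. e \<in> E \<Longrightarrow> card e = 2"
    and size: "\<And>i. i \<in> {1..3} \<Longrightarrow> l \<le> real (card (P i))" "l > 0"
    and m: "m > 0"
  shows "(\<Sum>i\<in>{1..3}. \<Sum>j\<in>{1..3}. pair_density E (P i) (P j))
    \<le> 5 + 3 / m + 243 * real m ^ 3 * (card (bad_triples E P) / l ^ 3)"
proof -
  \<comment> \<open>The label \<open>(i, j)\<close> stands for sample \<open>j\<close> from
    \<open>P i\<close>, and a function in \<open>D\<close> is one choice of all samples.\<close>
  define I where "I = {1..3::nat} \<times> {..<m}"
  define S where "S u = P (fst u)" for u :: "nat \<times> nat"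
  define D where "D = PiE I S"
  define r where "r \<phi> u v \<longleftrightarrow> {\<phi> u, \<phi> v} \<in> E" for \<phi> :: "nat \<times> nat \<Rightarrow> 'a" and u v
  define H where "H \<phi> = (\<Sum>u\<in>I. \<Sum>v\<in>I. of_bool (r \<phi> u v) :: real)" for \<phi>
  define R where "R = bad_triples E P"
  define bad where "bad t = {\<phi>\<in>D. case t of (u, v, x) \<Rightarrow> (\<phi> u, \<phi> v, \<phi> x) \<in> R \<inter> S u \<times> S v \<times> S x}" for t
  define Bad where "Bad = (\<Union>t\<in>I\<times>I\<times>I. bad t)"
  define M where "M = real (card D)"
  have I: "finite I" "card I = 3 * m" by (simp_all add: I_def)
  have fS: "finite (S u)" "l \<le> real (card (S u))" "card (S u) > 0" if "u \<in> I" for u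
  proof -
    from that have "fst u \<in> {1..3}" by (auto simp: I_def)
    with fin size show "finite (S u)" "l \<le> real (card (S u))" by (auto simp: S_def)
    with size show "card (S u) > 0" by linarith
  qed
  have fD: "finite D" unfolding D_def using I fS by (intro finite_PiE) auto
  have Mpos: "M > 0"
  proof -
    have "card D = (\<Prod>u\<in>I. card (S u))" unfolding D_def by (rule card_PiE[OF I(1)])
    also have "\<dots> > 0" using fS by (intro prod_pos) auto
    finally show ?thesis by (simp add: M_def)
  qed
  have irrefl: "\<not> r \<phi> u u" for \<phi> u using E[of "{\<phi> u}"] by (auto simp: r_def)
  have R_ne: "a \<noteq> b \<and> b \<noteq> c \<and> a \<noteq> c" if "(a, b, c) \<in> R" for a b c
    using that E[of "{a}"] E[of "{b}"] by (auto simp: R_def bad_triples_def)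
  have fR: "finite R"
  proof (rule finite_subset)
    show "R \<subseteq> (\<Union>i\<in>{1..3}. P i) \<times> (\<Union>i\<in>{1..3}. P i) \<times> (\<Union>i\<in>{1..3}. P i)"
      by (fastforce simp: R_def bad_triples_def bad_types_def)
  qed (use fin in auto)

  have bad_card: "real (card (bad t)) \<le> M * (card R / l ^ 3)" if "t \<in> I \<times> I \<times> I" for t
  proof -
    obtain u v x where t: "t = (u, v, x)" by (metis prod.exhaust)
    with that have uvx: "u \<in> I" "v \<in> I" "x \<in> I" by auto
    show ?thesis
    proof (cases "u \<noteq> v \<and> v \<noteq> x \<and> u \<noteq> x")
      case False
      \<comment> \<open>Equal labels have equal values, while the entries of a bad triple are
        distinct.\<close>
      then have "bad t = {}" using R_ne by (auto simp: bad_def t)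
      then show ?thesis using Mpos size by simp
    next
      case True
      define X where "X = R \<inter> S u \<times> S v \<times> S x"
      have "bad t = {\<phi> \<in> PiE I S. (\<phi> u, \<phi> v, \<phi> x) \<in> X}" by (simp add: bad_def t D_def X_def)
      then have "card (bad t) * (card (S u) * card (S v) * card (S x)) = card X * card D"
        unfolding D_def by (simp only:) (rule card_PiE_triple, use I fS uvx True in \<open>auto simp: X_def\<close>)
      then have eq: "real (card (bad t)) * (real (card (S u)) * real (card (S v)) * real (card (S x)))
          = real (card X) * M"
        unfolding M_def of_nat_mult[symmetric] by (rule arg_cong)
      have "real (card (bad t)) * l ^ 3
          \<le> real (card (bad t)) * (real (card (S u)) * real (card (S v)) * real (card (S x)))"
        unfolding power3_eq_cube using fS uvx size by (intro mult_left_mono mult_mono) auto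
      also have "\<dots> \<le> real (card R) * M"
        unfolding eq using Mpos card_mono[OF fR, of X] by (intro mult_right_mono) (auto simp: X_def)
      finally show ?thesis using size by (simp add: field_simps)
    qed
  qed
  have Bad_card: "real (card Bad) \<le> 27 * real m ^ 3 * (M * (card R / l ^ 3))"
  proof -
    have "card Bad \<le> (\<Sum>t\<in>I\<times>I\<times>I. card (bad t))"
      unfolding Bad_def using I by (intro card_UN_le) auto
    then have "real (card Bad) \<le> (\<Sum>t\<in>I\<times>I\<times>I. real (card (bad t)))"
      by (metis of_nat_mono of_nat_sum)
    also have "\<dots> \<le> (\<Sum>t\<in>I\<times>I\<times>I. M * (card R / l ^ 3))"
      by (intro sum_mono bad_card)
    also have "\<dots> = 27 * real m ^ 3 * (M * (card R / l ^ 3))"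
      by (simp add: card_cartesian_product I power3_eq_cube)
    finally show ?thesis .
  qed

  have H_triv: "H \<phi> \<le> 9 * real m ^ 2" for \<phi>
  proof -
    have "H \<phi> \<le> (\<Sum>u\<in>I. \<Sum>v\<in>I. 1)" unfolding H_def by (intro sum_mono) auto
    then show ?thesis by (simp add: I power2_eq_square)
  qed
  have H_good: "H \<phi> \<le> 5 * real m ^ 2" if "\<phi> \<in> D" "\<phi> \<notin> Bad" for \<phi>
  proof -
    \<comment> \<open>Weight \<open>1 / m\<close> on each label gives every part total weight 1 and
      turns the form into \<open>H \<phi> / m^2\<close>.\<close>
    have "form I (r \<phi>) (\<lambda>_. 1 / real m) \<le> 5"
    proof (rule form_le_5[where \<kappa> = fst])
      show "(\<Sum>u\<in>I. if fst u = i then 1 / real m else 0) = 1" if "i \<in> {1..3}" for i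
      proof -
        have "(\<Sum>u\<in>I. if fst u = i then 1 / real m else 0)
            = real m * (\<Sum>j\<in>{1..3}. if j = i then 1 / real m else 0)"
          unfolding I_def using sum_fst_Times[of "\<lambda>j. if j = i then 1 / real m else 0" "{1..3}" "{..<m}"]
          by simp
        then show ?thesis using that m by simp
      qed
      show "(fst u, fst v, fst x) \<notin> bad_types"
        if uvx: "u \<in> I" "v \<in> I" "x \<in> I" and adj: "r \<phi> u v" "r \<phi> v x" "r \<phi> u x" for u v x
      proof
        assume *: "(fst u, fst v, fst x) \<in> bad_types"
        have S: "\<phi> u \<in> S u" "\<phi> v \<in> S v" "\<phi> x \<in> S x"
          using \<open>\<phi> \<in> D\<close> uvx by (auto simp: D_def PiE_iff)
        then have "(\<phi> u, \<phi> v, \<phi> x) \<in> R"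
          using adj * unfolding R_def bad_triples_def r_def S_def by auto
        then have "\<phi> \<in> bad (u, v, x)" using S \<open>\<phi> \<in> D\<close> by (simp add: bad_def)
        then show False using \<open>\<phi> \<notin> Bad\<close> uvx unfolding Bad_def by blast
      qed
    qed (use I irrefl in \<open>auto simp: r_def I_def insert_commute\<close>)
    moreover have "form I (r \<phi>) (\<lambda>_. 1 / real m) = H \<phi> / real m ^ 2"
      unfolding form_def H_def sum_divide_distrib by (simp add: power2_eq_square)
    ultimately show ?thesis using m by (simp add: divide_le_eq)
  qed
  have upper: "(\<Sum>\<phi>\<in>D. H \<phi>) \<le> 5 * real m ^ 2 * M + 9 * real m ^ 2 * card Bad"
  proof -
    have "(\<Sum>\<phi>\<in>D. H \<phi>) \<le> (\<Sum>\<phi>\<in>D. 5 * real m ^ 2 + (if \<phi> \<in> Bad then 9 * real m ^ 2 else 0))"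
    proof (rule sum_mono)
      fix \<phi> assume "\<phi> \<in> D"
      then show "H \<phi> \<le> 5 * real m ^ 2 + (if \<phi> \<in> Bad then 9 * real m ^ 2 else 0)"
        using H_triv[of \<phi>] H_good[of \<phi>] by (cases "\<phi> \<in> Bad") (simp_all del: of_nat_power, use zero_le_power2[of "real m"] in linarith)
    qed
    also have "\<dots> = 5 * real m ^ 2 * M + 9 * real m ^ 2 * card (D \<inter> Bad)"
      using fD by (simp add: sum.distrib M_def sum.inter_restrict[symmetric])
    also have "D \<inter> Bad = Bad" by (auto simp: Bad_def bad_def)
    finally show ?thesis .
  qed

  let ?d = "\<lambda>i j. pair_density E (P i) (P j)"
  \<comment> \<open>Off the diagonal equality holds. On it the left side is 0, and subtracting
    \<open>M\<close> compensates because a density is at most 1.\<close>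
  have pair: "(\<Sum>\<phi>\<in>D. of_bool (r \<phi> u v)) \<ge> M * ?d (fst u) (fst v) - (if v = u then M else 0)"
    if uv: "u \<in> I" "v \<in> I" for u v
  proof (cases "u = v")
    case True
    have "M * ?d (fst u) (fst v) \<le> M * 1"
      using Mpos fS uv by (intro mult_left_mono pair_density_le_1) (auto simp: S_def)
    then show ?thesis using True irrefl by simp
  next
    case False
    define X where "X = {(a, b) \<in> S u \<times> S v. {a, b} \<in> E}"
    have "card {\<phi> \<in> PiE I S. (\<phi> u, \<phi> v) \<in> X} * (card (S u) * card (S v)) = card X * card D"
      unfolding D_def by (rule card_PiE_pair) (use I fS uv False in \<open>auto simp: X_def\<close>)
    moreover have "{\<phi> \<in> PiE I S. (\<phi> u, \<phi> v) \<in> X} = {\<phi> \<in> D. r \<phi> u v}"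
      using uv by (auto simp: X_def D_def r_def PiE_iff)
    ultimately have "card {\<phi> \<in> D. r \<phi> u v} * (card (S u) * card (S v)) = card X * card D"
      by simp
    then have *: "real (card {\<phi> \<in> D. r \<phi> u v}) * (real (card (S u)) * real (card (S v))) = real (card X) * M"
      unfolding M_def of_nat_mult[symmetric] by (rule arg_cong)
    have "real (card {\<phi> \<in> D. r \<phi> u v}) = M * ?d (fst u) (fst v)"
    proof -
      have aux: "x = M * (y / (p * q))" if "x * (p * q) = y * M" "0 < p" "0 < q" for x y p q :: real
        using that by (simp add: field_simps)
      show ?thesis
        unfolding pair_density_def
        by (subst of_nat_mult, rule aux)
          (use * fS(3)[OF uv(1)] fS(3)[OF uv(2)] in \<open>simp_all only: X_def S_def of_nat_0_less_iff\<close>)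
    qed
    moreover have "(\<Sum>\<phi>\<in>D. of_bool (r \<phi> u v)) = real (card {\<phi> \<in> D. r \<phi> u v})"
      using fD by (simp add: Int_def)
    ultimately show ?thesis using False by simp
  qed
  have lower: "(\<Sum>\<phi>\<in>D. H \<phi>) \<ge> M * (real m ^ 2 * (\<Sum>i\<in>{1..3}. \<Sum>j\<in>{1..3}. ?d i j)) - 3 * real m * M"
  proof -
    have 1: "(\<Sum>u\<in>I. \<Sum>v\<in>I. M * ?d (fst u) (fst v) - (if v = u then M else 0))
        = M * (\<Sum>u\<in>I. \<Sum>v\<in>I. ?d (fst u) (fst v)) - 3 * real m * M"
      using I by (simp add: sum_subtractf sum_distrib_left)
    have 2: "(\<Sum>u\<in>I. \<Sum>v\<in>I. ?d (fst u) (fst v)) = real m ^ 2 * (\<Sum>i\<in>{1..3}. \<Sum>j\<in>{1..3}. ?d i j)"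
    proof -
      have *: "(\<Sum>u\<in>I. f (fst u)) = real m * (\<Sum>i\<in>{1..3}. f i)" for f :: "nat \<Rightarrow> real"
        unfolding I_def sum_fst_Times by simp
      have "(\<Sum>u\<in>I. \<Sum>v\<in>I. ?d (fst u) (fst v)) = (\<Sum>u\<in>I. real m * (\<Sum>j\<in>{1..3}. ?d (fst u) j))"
        by (simp only: *[of "\<lambda>j. ?d (fst u) j" for u])
      also have "\<dots> = real m * (\<Sum>i\<in>{1..3}. real m * (\<Sum>j\<in>{1..3}. ?d i j))"
        by (rule *[of "\<lambda>i. real m * (\<Sum>j\<in>{1..3}. ?d i j)"])
      finally show ?thesis
        by (simp only: sum_distrib_left[symmetric] power2_eq_square mult.assoc)
    qed
    have "M * (real m ^ 2 * (\<Sum>i\<in>{1..3}. \<Sum>j\<in>{1..3}. ?d i j)) - 3 * real m * M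
        \<le> (\<Sum>u\<in>I. \<Sum>v\<in>I. \<Sum>\<phi>\<in>D. of_bool (r \<phi> u v))"
      unfolding 1[unfolded 2, symmetric] by (intro sum_mono pair)
    also have "\<dots> = (\<Sum>\<phi>\<in>D. H \<phi>)"
      unfolding H_def by (subst (2) sum.swap, subst sum.swap) (rule refl)
    finally show ?thesis .
  qed
  define s where "s = (\<Sum>i\<in>{1..3}. \<Sum>j\<in>{1..3}. ?d i j)"
  have "M * (real m ^ 2 * s) \<le> 5 * real m ^ 2 * M + 3 * real m * M
      + 9 * real m ^ 2 * (27 * real m ^ 3 * (M * (card R / l ^ 3)))"
    using upper lower mult_left_mono[OF Bad_card, of "9 * real m ^ 2"] unfolding s_def by simp
  also have "\<dots> = M * (real m ^ 2 * (5 + 3 / m + 243 * real m ^ 3 * (card R / l ^ 3)))"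
    using m by (simp add: field_simps power2_eq_square)
  finally have "real m ^ 2 * s \<le> real m ^ 2 * (5 + 3 / m + 243 * real m ^ 3 * (card R / l ^ 3))"
    using Mpos by (subst (asm) mult_le_cancel_left_pos)
  then have "s \<le> 5 + 3 / m + 243 * real m ^ 3 * (card R / l ^ 3)"
    by (subst (asm) mult_le_cancel_left_pos) (use m in auto)
  then show ?thesis unfolding s_def R_def .
qed

section \<open>Edges, bad triangles and \<open>rho3\<close>\<close>

lemma card_edges_le:
  assumes "simple_graph V E" "tripartition V P"
    and "\<And>i. i \<in> {1..3} \<Longrightarrow> real (card (P i)) \<le> L"
  shows "2 * real (card E) \<le> L\<^sup>2 * (\<Sum>i\<in>{1..3}. \<Sum>j\<in>{1..3}. pair_density E (P i) (P j))"
proof -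
  have V: "finite V" "V = (\<Union>i\<in>{1..3}. P i)" and E: "\<And>e. e \<in> E \<Longrightarrow> e \<subseteq> V \<and> card e = 2"
    using assms by (auto simp: simple_graph_def tripartition_def)
  have fin: "finite (P i)" if "i \<in> {1..3}" for i
    using V that by (auto intro: finite_subset)
  define X where "X i j = {(a, b) \<in> P i \<times> P j. {a, b} \<in> E}" for i j
  define Y where "Y = {(a, b). {a, b} \<in> E}"
  have YV: "Y \<subseteq> V \<times> V" using E by (auto simp: Y_def)
  then have fY: "finite Y" using V(1) by (simp add: finite_subset)
  have fE: "finite E" using E V(1) by (intro finite_subset[of E "Pow V"]) auto
  \<comment> \<open>Every edge has exactly two orderings, and different edges have different
    ones.\<close>
  have "2 * card E = card Y"
  proof -
    have Y: "Y = (\<Union>e\<in>E. {t. case t of (a, b) \<Rightarrow> {a, b} = e})" by (auto simp: Y_def)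
    have two: "card {t. case t of (a, b) \<Rightarrow> {a, b} = e} = 2" if "e \<in> E" for e
    proof -
      from E[OF that] obtain a b where ab: "e = {a, b}" "a \<noteq> b" by (auto simp: card_2_iff)
      then have "{t. case t of (a, b) \<Rightarrow> {a, b} = e} = {(a, b), (b, a)}"
        by (auto simp: doubleton_eq_iff)
      then show ?thesis using ab by simp
    qed
    have "card Y = (\<Sum>e\<in>E. card {t. case t of (a, b) \<Rightarrow> {a, b} = e})"
      unfolding Y
    proof (rule card_UN_disjoint[OF fE])
      \<comment> \<open>An infinite set would have \<open>card\<close> 0 and not 2.\<close>
      show "\<forall>e\<in>E. finite {t. case t of (a, b) \<Rightarrow> {a, b} = e}"
        using two by (metis card.infinite zero_neq_numeral)
    qed auto
    then show ?thesis using two by simp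
  qed
  also have "card Y \<le> (\<Sum>(i,j)\<in>{1..3}\<times>{1..3}. card (X i j))"
  proof -
    have "Y \<subseteq> (\<Union>t\<in>{1..3}\<times>{1..3}. X (fst t) (snd t))"
      using YV V(2) by (force simp: Y_def X_def)
    moreover have "finite (\<Union>t\<in>{1..3}\<times>{1..3}. X (fst t) (snd t))"
      using fY by (intro finite_subset[OF _ fY]) (auto simp: X_def Y_def)
    ultimately have "card Y \<le> card (\<Union>t\<in>{1..3}\<times>{1..3}. X (fst t) (snd t))" by (intro card_mono)
    also have "\<dots> \<le> (\<Sum>t\<in>{1..3}\<times>{1..3}. card (X (fst t) (snd t)))" by (intro card_UN_le) auto
    finally show ?thesis by (simp add: case_prod_unfold)
  qed
  also have "\<dots> = (\<Sum>i\<in>{1..3}. \<Sum>j\<in>{1..3}. card (X i j))" by (rule sum.cartesian_product[symmetric])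
  finally have "real (2 * card E) \<le> real (\<Sum>i\<in>{1..3}. \<Sum>j\<in>{1..3}. card (X i j))"
    by (rule of_nat_mono)
  then have "2 * real (card E) \<le> (\<Sum>i\<in>{1..3}. \<Sum>j\<in>{1..3}. real (card (X i j)))" by simp
  also have "\<dots> \<le> (\<Sum>i\<in>{1..3}. \<Sum>j\<in>{1..3}. L\<^sup>2 * pair_density E (P i) (P j))"
  proof (intro sum_mono)
    fix i j assume ij: "i \<in> {1..3::nat}" "j \<in> {1..3::nat}"
    have d: "pair_density E (P i) (P j) \<ge> 0" by (simp add: pair_density_def)
    have "real (card (X i j)) = real (card (P i)) * real (card (P j)) * pair_density E (P i) (P j)"
    \<comment> \<open>For an empty part the quotient in \<open>pair_density\<close> divides by zero;
      both sides are then 0.\<close>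
    proof (cases "card (P i) = 0 \<or> card (P j) = 0")
      case True
      then have "X i j = {}" using fin ij by (auto simp: X_def)
      then show ?thesis using True by auto
    qed (simp add: pair_density_def X_def)
    also have "\<dots> \<le> L\<^sup>2 * pair_density E (P i) (P j)"
      unfolding power2_eq_square using assms(3) ij d of_nat_0_le_iff[of "card (P i)"]
      by (intro mult_right_mono mult_mono) (auto intro: order_trans[of _ "real (card (P i))"])
    finally show "real (card (X i j)) \<le> L\<^sup>2 * pair_density E (P i) (P j)" .
  qed
  finally show ?thesis by (simp add: sum_distrib_left)
qed

text \<open>A bad triple lies in \<open>T \<times> T \<times> T\<close> for a triangle
  \<open>T\<close> counted by \<open>rho3\<close>, and this product has 27 elements. The bound
  \<open>card V ^ 3\<close> on the number of 3-subsets is equally crude; such constants are absorbed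
  by \<open>\<delta>\<close>.\<close>

lemma card_bad_triples_le:
  assumes "simple_graph V E" "tripartition V P" "card V \<ge> 3"
  shows "real (card (bad_triples E P)) \<le> 27 * rho3 V E P * real (card V) ^ 3"
proof -
  have V: "finite V" "V = (\<Union>i\<in>{1..3}. P i)" and E: "\<And>e. e \<in> E \<Longrightarrow> e \<subseteq> V \<and> card e = 2"
    using assms by (auto simp: simple_graph_def tripartition_def)
  define U where "U = {T. T \<subseteq> V \<and> card T = 3}"
  define B where "B = {T. triangle_of_type E P 1 2 3 T \<or> triangle_of_type E P 1 1 2 T \<or>
           triangle_of_type E P 2 2 3 T \<or> triangle_of_type E P 3 3 1 T}"
  have U: "finite U" "card U = card V choose 3"
    using V n_subsets[of V 3] by (auto simp: U_def)
  then have Upos: "card U > 0" using assms(3) by simp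
  then have "U \<noteq> {}" by auto
  then have rho: "rho3 V E P = card (U \<inter> B) / card U"
    unfolding rho3_def U_def[symmetric] B_def[symmetric] using U by (simp add: measure_pmf_of_set)
  have "bad_triples E P \<subseteq> (\<Union>T\<in>U \<inter> B. T \<times> T \<times> T)"
  proof
    fix t assume t: "t \<in> bad_triples E P"
    obtain a b c where abc: "t = (a, b, c)" by (metis prod.exhaust)
    have e: "{a, b} \<in> E" "{b, c} \<in> E" "{a, c} \<in> E" using t by (auto simp: abc bad_triples_def)
    then have "a \<noteq> b" "b \<noteq> c" "a \<noteq> c" using E[of "{a}"] E[of "{b}"] by auto
    then have c3: "card {a, b, c} = 3" by simp
    moreover have "{a, b, c} \<subseteq> V" using E[OF e(1)] E[OF e(2)] by auto
    moreover have "{a, b, c} \<in> B"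
    proof -
      obtain i j k where "(i, j, k) \<in> bad_types" "a \<in> P i" "b \<in> P j" "c \<in> P k"
        using t by (auto simp: abc bad_triples_def)
      then have "triangle_of_type E P i j k {a, b, c}" "(i, j, k) \<in> bad_types"
        using e c3 unfolding triangle_of_type_def by blast+
      then show ?thesis by (auto simp: B_def bad_types_def)
    qed
    ultimately have "{a, b, c} \<in> U \<inter> B" by (simp add: U_def)
    then show "t \<in> (\<Union>T\<in>U \<inter> B. T \<times> T \<times> T)" unfolding abc by (rule UN_I) simp
  qed
  moreover have "finite (\<Union>T\<in>U \<inter> B. T \<times> T \<times> T)"
  proof (rule finite_UN_I)
    fix T assume "T \<in> U \<inter> B"
    then have "T \<subseteq> V" by (simp add: U_def)
    then have "finite T" using V(1) by (rule finite_subset)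
    then show "finite (T \<times> T \<times> T)" by simp
  qed (simp add: U)
  ultimately have "card (bad_triples E P) \<le> card (\<Union>T\<in>U \<inter> B. T \<times> T \<times> T)" by (intro card_mono)
  also have "\<dots> \<le> (\<Sum>T\<in>U \<inter> B. card (T \<times> T \<times> T))" using U by (intro card_UN_le finite_Int) simp
  also have "\<dots> = (\<Sum>T\<in>U \<inter> B. 27)" by (intro sum.cong) (auto simp: U_def card_cartesian_product)
  finally have "card (bad_triples E P) \<le> 27 * card (U \<inter> B)" by simp
  then have "real (card (bad_triples E P)) \<le> 27 * real (card (U \<inter> B))" by linarith
  also have "\<dots> = 27 * rho3 V E P * real (card U)" using Upos rho by simp
  also have "\<dots> \<le> 27 * rho3 V E P * real (card V) ^ 3"
  proof (intro mult_left_mono)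
    have "card U \<le> card V ^ 3" unfolding U(2) by (rule binomial_le_pow[OF assms(3)])
    then show "real (card U) \<le> real (card V) ^ 3" by (metis of_nat_mono of_nat_power)
  qed (simp add: rho3_def)
  finally show ?thesis .
qed

section \<open>The edge bound and its constants\<close>

theorem theorem2p1:
  fixes \<epsilon> :: real
  assumes "\<epsilon> > 0"
  shows "\<exists>\<delta>::real. \<delta> > 0 \<and> (\<exists>N::nat. \<forall>n::nat. n \<ge> N \<longrightarrow>
           (\<forall>(V :: 'a set) (E :: 'a set set) (P :: nat \<Rightarrow> 'a set).
              simple_graph V E \<longrightarrow> tripartition V P \<longrightarrow>
              Max ((\<lambda>i. \<bar>real (card (P i)) - real n\<bar>) ` {1..3}) \<le> \<delta> * real n \<longrightarrow>
              rho3 V E P \<le> \<delta> \<longrightarrow>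
              real (card E) \<le> 5 / 2 * (real n)\<^sup>2 + \<epsilon> * (real n)\<^sup>2))"
proof -
  \<comment> \<open>The cap at 1 gives \<open>e * e \<le> e\<close> in the final estimate.\<close>
  define e where "e = min \<epsilon> 1"
  have e: "0 < e" "e \<le> 1" "e \<le> \<epsilon>" using assms by (auto simp: e_def)
  \<comment> \<open>This makes the sampling error \<open>3 / m\<close> at most
    \<open>e / 2\<close>.\<close>
  obtain m :: nat where m: "6 / e \<le> real m" using real_arch_simple by blast
  have "0 < 6 / e" using e by simp
  with m have m_pos: "m > 0" by (cases "m = 0") auto
  \<comment> \<open>The constant is \<open>2 * 243 * 27000\<close>, which makes the error from bad
    samples at most \<open>e / 2\<close>. Here \<open>27000 = 27 * 5^3 * 2^3\<close> combines the
    factor of \<open>card_bad_triples_le\<close>, \<open>card V \<le> 5 * n\<close> and parts of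
    size at least \<open>n / 2\<close>.\<close>
  define \<delta> where "\<delta> = e / (13122000 * real m ^ 3)"
  have "1 \<le> real m ^ 3" using m_pos by (intro one_le_power) simp
  then have \<delta>: "0 < \<delta>" "\<delta> \<le> e / 18"
    using e unfolding \<delta>_def by (intro divide_pos_pos divide_left_mono; linarith)+
  have "real (card E) \<le> 5 / 2 * (real n)\<^sup>2 + \<epsilon> * (real n)\<^sup>2"
    if n: "n \<ge> 1" and G: "simple_graph V E" "tripartition V P"
      and max: "Max ((\<lambda>i. \<bar>real (card (P i)) - real n\<bar>) ` {1..3}) \<le> \<delta> * real n"
      and rho: "rho3 V E P \<le> \<delta>"
    for n :: nat and V :: "'a set" and E :: "'a set set" and P :: "nat \<Rightarrow> 'a set"
  proof -
    have V: "finite V" "V = (\<Union>i\<in>{1..3}. P i)" "disjoint_family_on P {1..3}"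
      using G by (auto simp: simple_graph_def tripartition_def)
    have fin: "finite (P i)" if "i \<in> {1..3}" for i
      using V that by (auto intro: finite_subset)
    have dev: "\<bar>real (card (P i)) - real n\<bar> \<le> \<delta> * real n" if "i \<in> {1..3}" for i
    proof -
      have "\<bar>real (card (P i)) - real n\<bar> \<le> Max ((\<lambda>i. \<bar>real (card (P i)) - real n\<bar>) ` {1..3})"
        using that by (intro Max_ge) auto
      also note max
      finally show ?thesis .
    qed
    have "\<delta> * real n \<le> 1 / 2 * real n" using \<delta> e by (intro mult_right_mono) auto
    then have size: "real n / 2 \<le> real (card (P i))" "real (card (P i)) \<le> 3 / 2 * real n"
        "real (card (P i)) \<le> (1 + \<delta>) * real n" if "i \<in> {1..3}" for i
      using dev[OF that] by (auto simp: algebra_simps)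
    have card_V: "card V = (\<Sum>i\<in>{1..3}. card (P i))"
      using V fin by (simp add: card_UN_disjoint disjoint_family_on_def)
    have "real (card V) \<le> (\<Sum>i\<in>{1..3::nat}. 3 / 2 * real n)"
      unfolding card_V of_nat_sum by (intro sum_mono size)
    then have V_upper: "real (card V) \<le> 5 * real n" by simp
    \<comment> \<open>The parts are nonempty, so there are three vertices and \<open>rho3\<close> is
      meaningful.\<close>
    have "(\<Sum>i\<in>{1..3::nat}. 1) \<le> card V"
      unfolding card_V
    proof (rule sum_mono)
      fix i :: nat assume "i \<in> {1..3}"
      from size(1)[OF this] n have "real (card (P i)) > 0" by linarith
      then show "1 \<le> card (P i)" by linarith
    qed
    then have V_lower: "card V \<ge> 3" by simp
    define R where "R = real (card (bad_triples E P))"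
    have "R \<le> 27 * rho3 V E P * real (card V) ^ 3"
      unfolding R_def by (rule card_bad_triples_le[OF G V_lower])
    also have "\<dots> \<le> 27 * \<delta> * (5 * real n) ^ 3"
      using rho V_upper \<delta> by (intro mult_mono power_mono) (auto simp: rho3_def)
    finally have R: "R \<le> 3375 * \<delta> * real n ^ 3" by (simp add: power_mult_distrib)
    define s where "s = (\<Sum>i\<in>{1..3}. \<Sum>j\<in>{1..3}. pair_density E (P i) (P j))"
    have "s \<le> 5 + 3 / m + 243 * real m ^ 3 * (R / (real n / 2) ^ 3)"
      unfolding s_def R_def
      by (rule density_sum_le) (use fin G size n m_pos in \<open>auto simp: simple_graph_def\<close>)
    moreover have "3 / real m \<le> e / 2"
      using m m_pos e by (simp add: field_simps)
    moreover have "243 * real m ^ 3 * (R / (real n / 2) ^ 3) \<le> e / 2"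
    proof -
      have "R / (real n / 2) ^ 3 \<le> 27000 * \<delta>"
        using R n by (simp add: power_divide divide_le_eq)
      then have "243 * real m ^ 3 * (R / (real n / 2) ^ 3) \<le> 243 * real m ^ 3 * (27000 * \<delta>)"
        by (intro mult_left_mono) auto
      also have "\<dots> = e / 2" unfolding \<delta>_def using m_pos by simp
      finally show ?thesis .
    qed
    ultimately have s: "s \<le> 5 + e" by linarith
    have "2 * real (card E) \<le> ((1 + \<delta>) * real n)\<^sup>2 * s"
      unfolding s_def by (rule card_edges_le[OF G size(3)])
    also have "\<dots> \<le> ((1 + \<delta>) * real n)\<^sup>2 * (5 + e)"
      using s by (intro mult_left_mono) auto
    also have "\<dots> = ((1 + \<delta>)\<^sup>2 * (5 + e)) * (real n)\<^sup>2" by (simp add: power_mult_distrib)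
    also have "\<dots> \<le> (5 + 2 * \<epsilon>) * (real n)\<^sup>2"
    proof (rule mult_right_mono)
      \<comment> \<open>This gives \<open>(1 + \<delta>)^2 \<le> 1 + 3 * \<delta>\<close>, and
        \<open>\<delta> \<le> e / 18\<close> turns it into \<open>1 + e / 6\<close>. The product
        with \<open>5 + e\<close> exceeds 5 by at most \<open>2 * e\<close>.\<close>
      have "\<delta> * \<delta> \<le> 1 * \<delta>" using \<delta> e by (intro mult_right_mono) auto
      moreover have "(1 + \<delta>)\<^sup>2 = 1 + 2 * \<delta> + \<delta> * \<delta>" by (simp add: power2_eq_square algebra_simps)
      ultimately have "(1 + \<delta>)\<^sup>2 \<le> 1 + e / 6" using \<delta> by linarith
      then have "(1 + \<delta>)\<^sup>2 * (5 + e) \<le> (1 + e / 6) * (5 + e)" using e by (intro mult_right_mono) auto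
      also have "\<dots> = 5 + e + 5 / 6 * e + e * e / 6" by (simp add: field_simps)
      finally show "(1 + \<delta>)\<^sup>2 * (5 + e) \<le> 5 + 2 * \<epsilon>"
        using e mult_right_mono[of e 1 e] by linarith
    qed simp
    finally show ?thesis by (simp add: algebra_simps)
  qed
  then show ?thesis using \<delta>(1) by blast
qed

end
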